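(* Let $\widetilde f$ be a prediction procedure and let $\mathcal{I}$ be an open set in $(0,\infty)$. Suppose there exists a function $R^{\mathrm{det}}(\cdot;\widetilde f):(0,\infty]\to[0,\infty]$ such that, for datasets $\mathcal{D}_{k_m}$ with $k_m$ observations and $p_m$ features, $$R(\widetilde f(\cdot;\mathcal{D}_{k_m}))\to R^{\mathrm{det}}(\phi;\widetilde f)\quad\text{in probability}$$ as $k_m,p_m\to\infty$ and $p_m/k_m\to\phi\in\mathcal{I}$ (that is, for every $\phi\in\mathcal{I}$ and every such sequence of datasets). Then $R^{\mathrm{det}}(\cdot;\widetilde f)$ is continuous on $\mathcal{I}$.
   Context: For each pair of positive integers $(k,p)$, a dataset with $k$ observations and $p$ features consists of $k$ i.i.d. pairs in $\mathbb{R}^p\times\mathbb{R}$ from a distribution $P$ (which may depend on $k$ and $p$). A prediction procedure $\widetilde f$ maps a dataset $\mathcal{D}$ to a predictor $\widetilde f(\cdot;\mathcal{D}):\mathbb{R}^p\to\mathbb{R}$. For a non-negative loss $\ell:\mathbb{R}\times\mathbb{R}\to\mathbb{R}_{\ge0}$, the conditional prediction risk is $R(\widetilde f(\cdot;\mathcal{D}))=\int\ell(y,\widetilde f(x;\mathcal{D}))\,dP(x,y)$, a random variable depending on $\mathcal{D}$. *)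

theory Defs
  imports "HOL-Probability.Probability"
begin

text \<open>
  Vectors in \<open>\<real>\<^sup>p\<close> are represented by functions on \<open>{..<p}\<close>, so that the
  dimension \<open>p\<close> can vary inside a formula.  A dataset with \<open>k\<close> observations is a function on
  \<open>{..<k}\<close> whose \<open>i\<close>-th value is the pair (features, response).
\<close>

type_synonym obs = "(nat \<Rightarrow> real) \<times> real"
type_synonym dataset = "nat \<Rightarrow> obs"

definition feature_space :: "nat \<Rightarrow> (nat \<Rightarrow> real) measure" where
  "feature_space p = Pi\<^sub>M {..<p} (\<lambda>_. borel)"

definition obs_space :: "nat \<Rightarrow> obs measure" where
  "obs_space p = feature_space p \<Otimes>\<^sub>M borel"

definition data_distribution :: "nat \<Rightarrow> obs measure \<Rightarrow> bool" where
  "data_distribution p P \<longleftrightarrow> prob_space P \<and> sets P = sets (obs_space p)"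

text \<open>The law of a dataset of \<open>k\<close> i.i.d. observations from \<open>P\<close>.\<close>

definition dataset_law :: "nat \<Rightarrow> obs measure \<Rightarrow> dataset measure" where
  "dataset_law k P = Pi\<^sub>M {..<k} (\<lambda>_. P)"

text \<open>
  A procedure takes the sizes \<open>k\<close> and \<open>p\<close> explicitly, since they cannot be
  read off from a value of type \<^typ>\<open>dataset\<close>.
\<close>

type_synonym procedure = "nat \<Rightarrow> nat \<Rightarrow> dataset \<Rightarrow> (nat \<Rightarrow> real) \<Rightarrow> real"

definition prediction_procedure :: "procedure \<Rightarrow> bool" where
  "prediction_procedure f \<longleftrightarrow>
     (\<forall>k>0. \<forall>p>0. \<forall>D \<in> space (Pi\<^sub>M {..<k} (\<lambda>_. obs_space p)).
        f k p D \<in> borel_measurable (feature_space p))"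

definition risk ::
  "(real \<Rightarrow> real \<Rightarrow> real) \<Rightarrow> obs measure \<Rightarrow> ((nat \<Rightarrow> real) \<Rightarrow> real) \<Rightarrow> ennreal" where
  "risk loss P g = (\<integral>\<^sup>+ (x, y). ennreal (loss y (g x)) \<partial>P)"

text \<open>
  Convergence in probability to a constant in \<open>[0,\<infinity>]\<close>, for \<open>[0,\<infinity>]\<close>-valued random
  variables \<open>X m\<close> that may live on different probability spaces \<open>M m\<close>.  The limit \<open>\<infinity>\<close> means that
  \<open>X m\<close> exceeds every real bound with probability tending to 1.  The absolute difference
  is formed in \<^typ>\<open>ereal\<close> because subtraction on \<^typ>\<open>ennreal\<close> is truncated at 0.
\<close>

definition tendsto_in_prob ::
  "(nat \<Rightarrow> 'a measure) \<Rightarrow> (nat \<Rightarrow> 'a \<Rightarrow> ennreal) \<Rightarrow> ennreal \<Rightarrow> bool" where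
  "tendsto_in_prob M X c \<longleftrightarrow>
     (if c = \<infinity>
      then \<forall>K::real. (\<lambda>m. measure (M m) {\<omega> \<in> space (M m). X m \<omega> \<le> ennreal K}) \<longlonglongrightarrow> 0
      else \<forall>\<epsilon>>0. (\<lambda>m. measure (M m)
             {\<omega> \<in> space (M m). \<bar>enn2ereal (X m \<omega>) - enn2ereal c\<bar> > ereal \<epsilon>}) \<longlonglongrightarrow> 0)"

end

theory Submission
  imports Defs
begin

text \<open>
  Write \<open>X k p\<close> for the conditional risk with \<open>k\<close> observations and \<open>p\<close> features.  The hypothesis
  covers every sequence of sizes whose ratio \<open>p/k\<close> converges in \<open>I\<close>, and this freedom in the choice
  of the sequence forces continuity by a diagonal argument.  If the limit
  function \<open>r\<close> were discontinuous at \<open>\<phi>\<close>, there would be disjoint open sets \<open>V\<close> and \<open>W\<close> in \<open>[0,\<infinity>]\<close> with \<open>r \<phi> \<in> V\<close> and points \<open>\<psi>\<^sub>n \<rightarrow> \<phi>\<close> with \<open>r \<psi>\<^sub>n \<in> W\<close>.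
  For each \<open>n\<close>, convergence along some sequence of sizes with ratio tending to \<open>\<psi>\<^sub>n\<close>
  provides sizes \<open>k\<^sub>n\<close>, \<open>p\<^sub>n\<close> beyond \<open>n\<close> whose ratio is within \<open>1/(n+1)\<close> of \<open>\<psi>\<^sub>n\<close> and for which
  \<open>X k\<^sub>n p\<^sub>n\<close> misses \<open>W\<close> with probability below \<open>1/2\<close> (\<open>sizes_concentrating_in_open\<close>).  These chosen
  sizes form a sequence with ratio tending to \<open>\<phi>\<close>, so the probability that
  \<open>X k\<^sub>n p\<^sub>n\<close> misses \<open>V\<close> tends to \<open>0\<close>.  As \<open>V\<close> and \<open>W\<close> are disjoint, every outcome misses one of them,
  so these two probabilities add up to at least \<open>1\<close>, a contradiction
  (\<open>limit_eventually_avoids_separated_open\<close>).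

  The order topology of \<open>[0,\<infinity>]\<close> is dense, so opposite rays \<open>{b<..}\<close> and \<open>{..<b}\<close>
  serve as \<open>V\<close> and \<open>W\<close>, and the diagonal argument needs no separate treatment of infinite limits.
\<close>

section \<open>Convergence in probability and open sets\<close>

text \<open>
  The definition of convergence in probability to a constant treats finite and infinite limits
  differently; this consequence is the same in both cases and is all that the argument uses.
\<close>

lemma tendsto_in_prob_open:
  assumes lim: "tendsto_in_prob M X c"
    and prob: "\<And>m. prob_space (M m)"
    and meas: "\<And>m. X m \<in> borel_measurable (M m)"
    and V: "open V" "c \<in> V"
  shows "(\<lambda>m. measure (M m) {\<omega> \<in> space (M m). X m \<omega> \<notin> V}) \<longlonglongrightarrow> 0"
proof -
  \<comment> \<open>It suffices to cover the bad event by events whose probabilities tend to \<open>0\<close>.\<close>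
  have squeeze: ?thesis
    if B: "(\<lambda>m. measure (M m) (B m)) \<longlonglongrightarrow> 0" "\<And>m. B m \<in> sets (M m)"
      "\<And>m. {\<omega> \<in> space (M m). X m \<omega> \<notin> V} \<subseteq> B m" for B
  proof (rule tendsto_sandwich[OF _ _ tendsto_const B(1)])
    show "\<forall>\<^sub>F m in sequentially. measure (M m) {\<omega> \<in> space (M m). X m \<omega> \<notin> V} \<le> measure (M m) (B m)"
    proof (rule always_eventually, rule allI)
      fix m
      interpret prob_space "M m" by (rule prob)
      show "prob {\<omega> \<in> space (M m). X m \<omega> \<notin> V} \<le> prob (B m)"
        using B by (intro finite_measure_mono)
    qed
  qed simp
  show ?thesis
  proof (cases "c = \<infinity>")
    case True
    then obtain b where b: "b < \<infinity>" "{b<..\<infinity>} \<subseteq> V"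
      using open_left[OF V, of 0] by auto
    show ?thesis
    proof (rule squeeze)
      show "(\<lambda>m. measure (M m) {\<omega> \<in> space (M m). X m \<omega> \<le> ennreal (enn2real b)}) \<longlonglongrightarrow> 0"
        using lim True by (simp add: tendsto_in_prob_def)
      show "{\<omega> \<in> space (M m). X m \<omega> \<le> ennreal (enn2real b)} \<in> sets (M m)" for m
        using meas[of m] by measurable
      have "x \<le> ennreal (enn2real b)" if "x \<notin> V" for x
        using b that by (auto simp: less_top[symmetric] not_less[symmetric] subset_iff)
      then show "{\<omega> \<in> space (M m). X m \<omega> \<notin> V}
          \<subseteq> {\<omega> \<in> space (M m). X m \<omega> \<le> ennreal (enn2real b)}" for m
        by auto
    qed
  next
    case False
    then obtain r where r: "c = ennreal r" "0 \<le> r" by (cases c) auto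
    have "open (e2ennreal -` V)"
      using continuous_on_e2ennreal V(1) by (rule open_vimage[rotated])
    moreover have "enn2ereal c \<in> e2ennreal -` V" using V(2) by simp
    moreover have "\<bar>enn2ereal c\<bar> \<noteq> \<infinity>" using r by (simp add: enn2ereal_ennreal)
    ultimately obtain e where e: "e > 0"
        "{enn2ereal c - e <..< enn2ereal c + e} \<subseteq> e2ennreal -` V"
      by (rule ereal_open_cont_interval)
    obtain d where d: "0 < d" "ereal d < e"
      using ereal_dense2[OF e(1)] by auto
    show ?thesis
    proof (rule squeeze)
      let ?B = "\<lambda>m. {\<omega> \<in> space (M m). \<bar>enn2ereal (X m \<omega>) - enn2ereal c\<bar> > ereal d}"
      show "(\<lambda>m. measure (M m) (?B m)) \<longlonglongrightarrow> 0"
        using lim False d(1) by (simp add: tendsto_in_prob_def)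
      show "?B m \<in> sets (M m)" for m
        using meas[of m] by measurable
      have "ereal d < \<bar>enn2ereal x - enn2ereal c\<bar>" if "x \<notin> V" for x
      proof (rule ccontr)
        assume near: "\<not> ereal d < \<bar>enn2ereal x - enn2ereal c\<bar>"
        have "enn2ereal x \<in> {enn2ereal c - e <..< enn2ereal c + e}"
          using near d r
          by (cases "enn2ereal x"; cases e) (auto simp: enn2ereal_ennreal)
        with e(2) have "e2ennreal (enn2ereal x) \<in> V" by blast
        with that show False by simp
      qed
      then show "{\<omega> \<in> space (M m). X m \<omega> \<notin> V} \<subseteq> ?B m" for m
        by auto
    qed
  qed
qed

section \<open>The diagonal argument\<close>

text \<open>
  The witness takes \<open>m + 1\<close> observations and rounds \<open>\<psi> (m + 1)\<close> up, which keeps the number of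
  features positive.
\<close>

lemma sizes_with_ratio_tending_to:
  fixes \<psi> :: real
  assumes "\<psi> > 0"
  obtains k p :: "nat \<Rightarrow> nat"
  where "\<And>m. k m > 0" "\<And>m. p m > 0"
    "filterlim k at_top sequentially" "filterlim p at_top sequentially"
    "(\<lambda>m. real (p m) / real (k m)) \<longlonglongrightarrow> \<psi>"
proof
  define p where "p m = nat \<lceil>\<psi> * real (Suc m)\<rceil>" for m
  have prod_pos: "\<psi> * real (Suc m) > 0" for m
    using assms by simp
  have lower: "\<psi> * real (Suc m) \<le> real (p m)" for m
    unfolding p_def by (rule real_nat_ceiling_ge)
  have upper: "real (p m) \<le> \<psi> * real (Suc m) + 1" for m
    using prod_pos[of m] unfolding p_def by linarith
  show "Suc m > 0" for m by simp
  show "p m > 0" for m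
    using lower[of m] prod_pos[of m] by linarith
  show "filterlim Suc at_top sequentially"
    by (rule filterlim_Suc)
  have "filterlim (\<lambda>m. \<psi> * real (Suc m)) at_top sequentially"
    by (intro filterlim_tendsto_pos_mult_at_top[OF tendsto_const assms]
        filterlim_compose[OF filterlim_real_sequentially] filterlim_Suc)
  then have "filterlim (\<lambda>m. real (p m)) at_top sequentially"
    by (rule filterlim_at_top_mono) (intro always_eventually allI lower)
  then show "filterlim p at_top sequentially"
    by (simp add: filterlim_sequentially_iff_filterlim_real)
  show "(\<lambda>m. real (p m) / real (Suc m)) \<longlonglongrightarrow> \<psi>"
  proof (rule tendsto_sandwich)
    show "\<forall>\<^sub>F m in sequentially. \<psi> \<le> real (p m) / real (Suc m)"
      by (intro always_eventually allI) (simp add: pos_le_divide_eq lower del: of_nat_Suc)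
    have "real (p m) / real (Suc m) \<le> \<psi> + inverse (real (Suc m))" for m
      using upper[of m] by (simp add: field_simps del: of_nat_Suc)
    then show "\<forall>\<^sub>F m in sequentially. real (p m) / real (Suc m) \<le> \<psi> + inverse (real (Suc m))"
      by simp
    show "(\<lambda>m. \<psi> + inverse (real (Suc m))) \<longlonglongrightarrow> \<psi>"
      by (rule LIMSEQ_inverse_real_of_nat_add)
  qed simp
qed

text \<open>
  The setting of the diagonal argument: any doubly indexed family of \<open>[0,\<infinity>]\<close>-valued random
  variables whose limit in probability is a function of the limiting ratio of the two indices.
\<close>

locale ratio_limit =
  fixes M :: "nat \<Rightarrow> nat \<Rightarrow> 'a measure"
    and X :: "nat \<Rightarrow> nat \<Rightarrow> 'a \<Rightarrow> ennreal"
    and r :: "real \<Rightarrow> ennreal"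
    and I :: "real set"
  assumes prob: "\<And>k p. k > 0 \<Longrightarrow> p > 0 \<Longrightarrow> prob_space (M k p)"
    and meas: "\<And>k p. k > 0 \<Longrightarrow> p > 0 \<Longrightarrow> X k p \<in> borel_measurable (M k p)"
    and pos: "I \<subseteq> {0<..}"
    and conv: "\<And>\<phi> (k :: nat \<Rightarrow> nat) (p :: nat \<Rightarrow> nat).
      \<phi> \<in> I \<Longrightarrow> (\<And>m. k m > 0) \<Longrightarrow> (\<And>m. p m > 0) \<Longrightarrow>
      filterlim k at_top sequentially \<Longrightarrow> filterlim p at_top sequentially \<Longrightarrow>
      (\<lambda>m. real (p m) / real (k m)) \<longlonglongrightarrow> \<phi> \<Longrightarrow>
      tendsto_in_prob (\<lambda>m. M (k m) (p m)) (\<lambda>m. X (k m) (p m)) (r \<phi>)"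
begin

definition miss_prob :: "nat \<Rightarrow> nat \<Rightarrow> ennreal set \<Rightarrow> real" where
  "miss_prob k p V = measure (M k p) {\<omega> \<in> space (M k p). X k p \<omega> \<notin> V}"

lemma miss_prob_tendsto_0:
  assumes "\<phi> \<in> I" "\<And>m. k m > 0" "\<And>m. p m > 0"
    and "filterlim k at_top sequentially" "filterlim p at_top sequentially"
    and "(\<lambda>m. real (p m) / real (k m)) \<longlonglongrightarrow> \<phi>"
    and "open V" "r \<phi> \<in> V"
  shows "(\<lambda>m. miss_prob (k m) (p m) V) \<longlonglongrightarrow> 0"
  unfolding miss_prob_def
  using assms by (intro tendsto_in_prob_open[OF conv]) (auto intro: prob meas)

lemma miss_prob_disjoint:
  assumes "k > 0" "p > 0" "open V" "open W" "V \<inter> W = {}"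
  shows "1 \<le> miss_prob k p V + miss_prob k p W"
proof -
  interpret prob_space "M k p" using assms by (intro prob)
  have [measurable]: "X k p \<in> borel_measurable (M k p)" "V \<in> sets borel" "W \<in> sets borel"
    using assms by (auto intro: meas)
  let ?A = "\<lambda>U. {\<omega> \<in> space (M k p). X k p \<omega> \<notin> U}"
  have "?A V \<union> ?A W = space (M k p)" using assms(5) by auto
  then have "1 = prob (?A V \<union> ?A W)" by (simp add: prob_space)
  also have "\<dots> \<le> prob (?A V) + prob (?A W)" by (intro measure_Un_le) measurable
  finally show ?thesis by (simp add: miss_prob_def)
qed

text \<open>
  One stage of the diagonal choice: convergence along a single sequence of ratio tending to \<open>\<psi>\<close>
  already contains sizes meeting these three eventual requirements at once.
\<close>

lemma sizes_concentrating_in_open: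
  assumes "\<psi> \<in> I" "open W" "r \<psi> \<in> W" "\<epsilon> > 0"
  shows "\<exists>k p. k > 0 \<and> p > 0 \<and> k \<ge> N \<and> p \<ge> N \<and>
    \<bar>real p / real k - \<psi>\<bar> < \<epsilon> \<and> miss_prob k p W < 1/2"
proof -
  have "\<psi> > 0" using assms(1) pos by auto
  then obtain k p :: "nat \<Rightarrow> nat" where
    sizes: "\<And>m. k m > 0" "\<And>m. p m > 0"
      "filterlim k at_top sequentially" "filterlim p at_top sequentially"
      "(\<lambda>m. real (p m) / real (k m)) \<longlonglongrightarrow> \<psi>"
    by (rule sizes_with_ratio_tending_to) blast
  have "(\<lambda>m. miss_prob (k m) (p m) W) \<longlonglongrightarrow> 0"
    using assms(1) sizes assms(2,3) by (rule miss_prob_tendsto_0)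
  then have "\<forall>\<^sub>F m in sequentially. miss_prob (k m) (p m) W < 1/2"
    by (rule order_tendstoD) simp
  moreover have "\<forall>\<^sub>F m in sequentially. dist (real (p m) / real (k m)) \<psi> < \<epsilon>"
    using sizes(5) assms(4) by (rule tendstoD)
  moreover have "\<forall>\<^sub>F m in sequentially. N \<le> k m" "\<forall>\<^sub>F m in sequentially. N \<le> p m"
    using sizes(3,4) by (simp_all add: filterlim_at_top)
  ultimately have "\<forall>\<^sub>F m in sequentially. N \<le> k m \<and> N \<le> p m \<and>
      \<bar>real (p m) / real (k m) - \<psi>\<bar> < \<epsilon> \<and> miss_prob (k m) (p m) W < 1/2"
    by eventually_elim (simp add: dist_real_def)
  from eventually_happens'[OF sequentially_bot this] show ?thesis
    using sizes(1,2) by blast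
qed

text \<open>
  Otherwise, sizes concentrating in \<open>W\<close> can be chosen along points of \<open>I\<close> tending to \<open>\<phi>\<close>; their
  own ratios tend to \<open>\<phi>\<close>, so the same variables must also concentrate in \<open>V\<close>.
\<close>

lemma limit_eventually_avoids_separated_open:
  assumes "\<phi> \<in> I" "open V" "open W" "V \<inter> W = {}" "r \<phi> \<in> V"
  shows "\<forall>\<^sub>F \<psi> in at \<phi> within I. r \<psi> \<notin> W"
proof (rule ccontr)
  assume not_ev: "\<not> ?thesis"
  have "\<exists>k p. k > 0 \<and> p > 0 \<and> k \<ge> n \<and> p \<ge> n \<and>
      \<bar>real p / real k - \<phi>\<bar> < 2 * inverse (real (Suc n)) \<and> miss_prob k p W < 1/2" for n
  proof -
    have \<epsilon>: "inverse (real (Suc n)) > 0" by simp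
    with not_ev obtain \<psi> where \<psi>: "\<psi> \<in> I" "r \<psi> \<in> W" "dist \<psi> \<phi> < inverse (real (Suc n))"
      unfolding eventually_at by blast
    obtain k p where kp: "k > 0" "p > 0" "k \<ge> n" "p \<ge> n"
        "\<bar>real p / real k - \<psi>\<bar> < inverse (real (Suc n))" "miss_prob k p W < 1/2"
      using sizes_concentrating_in_open[OF \<psi>(1) assms(3) \<psi>(2) \<epsilon>] by blast
    have "\<bar>real p / real k - \<phi>\<bar> < 2 * inverse (real (Suc n))"
      using kp(5) \<psi>(3) unfolding dist_real_def by linarith
    with kp show ?thesis by blast
  qed
  then obtain k p where kp: "\<And>n. k n > 0" "\<And>n. p n > 0" "\<And>n. n \<le> k n" "\<And>n. n \<le> p n"
      "\<And>n. \<bar>real (p n) / real (k n) - \<phi>\<bar> < 2 * inverse (real (Suc n))"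
      "\<And>n. miss_prob (k n) (p n) W < 1/2"
    by metis
  have at_top: "filterlim k at_top sequentially" "filterlim p at_top sequentially"
    using kp(3,4) by (auto intro: filterlim_at_top_mono[OF filterlim_ident])
  have "(\<lambda>n. 2 * inverse (real (Suc n))) \<longlonglongrightarrow> 0"
    using tendsto_mult_left[OF LIMSEQ_inverse_real_of_nat, of 2] by simp
  then have "(\<lambda>n. real (p n) / real (k n) - \<phi>) \<longlonglongrightarrow> 0"
    by (rule Lim_null_comparison[rotated])
      (intro always_eventually allI, use kp(5) in \<open>simp add: less_imp_le del: of_nat_Suc\<close>)
  then have "(\<lambda>n. real (p n) / real (k n)) \<longlonglongrightarrow> \<phi>"
    by (rule LIM_zero_cancel)
  then have "(\<lambda>n. miss_prob (k n) (p n) V) \<longlonglongrightarrow> 0"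
    using assms kp(1,2) at_top by (intro miss_prob_tendsto_0)
  then have "\<forall>\<^sub>F n in sequentially. miss_prob (k n) (p n) V < 1/2"
    by (rule order_tendstoD) simp
  then obtain n where "miss_prob (k n) (p n) V < 1/2"
    using eventually_happens'[OF sequentially_bot] by blast
  with kp(6)[of n] miss_prob_disjoint[OF kp(1,2) assms(2,3,4), of n n]
  show False by linarith
qed

lemma continuous_on_limit: "continuous_on I r"
  unfolding continuous_on_def
proof (intro ballI order_tendstoI)
  fix \<phi> a
  assume \<phi>: "\<phi> \<in> I" and "a < r \<phi>"
  then obtain b where b: "a < b" "b < r \<phi>" using dense by blast
  have "\<forall>\<^sub>F \<psi> in at \<phi> within I. r \<psi> \<notin> {..<b}"
    using \<phi> b by (intro limit_eventually_avoids_separated_open[of _ "{b<..}"]) auto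
  then show "\<forall>\<^sub>F \<psi> in at \<phi> within I. a < r \<psi>"
    by eventually_elim (use b in auto)
next
  fix \<phi> a
  assume \<phi>: "\<phi> \<in> I" and "r \<phi> < a"
  then obtain b where b: "r \<phi> < b" "b < a" using dense by blast
  have "\<forall>\<^sub>F \<psi> in at \<phi> within I. r \<psi> \<notin> {b<..}"
    using \<phi> b by (intro limit_eventually_avoids_separated_open[of _ "{..<b}"]) auto
  then show "\<forall>\<^sub>F \<psi> in at \<phi> within I. r \<psi> < a"
    by eventually_elim (use b in auto)
qed

end

section \<open>Continuity of the deterministic risk\<close>

text \<open>
  On the nonnegative reals \<open>ennreal\<close> is a homeomorphism onto its image, with inverse \<open>enn2real\<close>.
\<close>

lemma continuous_on_ennreal_image:
  fixes g :: "ennreal \<Rightarrow> 'b :: topological_space"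
  assumes "I \<subseteq> {0..}" "continuous_on I (\<lambda>x. g (ennreal x))"
  shows "continuous_on (ennreal ` I) g"
proof -
  have "continuous_on (ennreal ` I) enn2real"
    unfolding continuous_on_def using assms(1)
    by (auto intro!: tendsto_enn2real tendsto_ident_at)
  moreover have "enn2real ` ennreal ` I \<subseteq> I"
    using assms(1) by (auto simp: subset_iff)
  ultimately have "continuous_on (ennreal ` I) (\<lambda>y. g (ennreal (enn2real y)))"
    using assms(2) by (rule continuous_on_compose2[rotated])
  then show ?thesis
    by (rule continuous_on_eq) auto
qed

theorem proposition3p10:
  fixes P :: "nat \<Rightarrow> nat \<Rightarrow> obs measure"
    and loss :: "real \<Rightarrow> real \<Rightarrow> real"
    and f :: procedure
    and I :: "real set"
    and Rdet :: "ennreal \<Rightarrow> ennreal"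
  assumes distr: "\<And>k p. k > 0 \<Longrightarrow> p > 0 \<Longrightarrow> data_distribution p (P k p)"
    and loss_nonneg: "\<And>a b. 0 \<le> loss a b"
    and loss_measurable: "case_prod loss \<in> borel_measurable (borel \<Otimes>\<^sub>M borel)"
    and procedure: "prediction_procedure f"
    and risk_random_variable: "\<And>k p. k > 0 \<Longrightarrow> p > 0 \<Longrightarrow>
      (\<lambda>D. risk loss (P k p) (f k p D)) \<in> borel_measurable (dataset_law k (P k p))"
    and I_open: "open I" and I_pos: "I \<subseteq> {0<..}"
    and conv: "\<And>\<phi> (k :: nat \<Rightarrow> nat) (p :: nat \<Rightarrow> nat).
      \<phi> \<in> I \<Longrightarrow> (\<And>m. k m > 0) \<Longrightarrow> (\<And>m. p m > 0) \<Longrightarrow>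
      filterlim k at_top sequentially \<Longrightarrow> filterlim p at_top sequentially \<Longrightarrow>
      (\<lambda>m. real (p m) / real (k m)) \<longlonglongrightarrow> \<phi> \<Longrightarrow>
      tendsto_in_prob (\<lambda>m. dataset_law (k m) (P (k m) (p m)))
        (\<lambda>m D. risk loss (P (k m) (p m)) (f (k m) (p m) D)) (Rdet (ennreal \<phi>))"
  shows "continuous_on (ennreal ` I) Rdet"
proof (rule continuous_on_ennreal_image)
  show "I \<subseteq> {0..}" using I_pos by auto
  interpret ratio_limit "\<lambda>k p. dataset_law k (P k p)"
    "\<lambda>k p D. risk loss (P k p) (f k p D)" "\<lambda>\<phi>. Rdet (ennreal \<phi>)" I
  proof (rule ratio_limit.intro)
    show "prob_space (dataset_law k (P k p))" if "k > 0" "p > 0" for k p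
      using distr[OF that] unfolding dataset_law_def data_distribution_def
      by (intro prob_space_PiM) simp
  qed (rule risk_random_variable I_pos conv; assumption)+
  show "continuous_on I (\<lambda>\<phi>. Rdet (ennreal \<phi>))"
    by (rule continuous_on_limit)
qed

end
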